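(* Let $\varphi$ be a gauge function with $\lim_{r\to0+}\varphi(r)/r=\infty$. Then the set $$\{f\in C[0,1]: \mathcal{H}^{\varphi}(f^{-1}(y))>0\text{ for all }y\in(\min f,\max f)\}$$ is non-shy in $C[0,1]$.
   Context: Shyness: for an abelian Polish group $G$, a set $A\subset G$ is shy if there exist a Borel set $B\supset A$ in $G$ and a Borel probability measure $\nu$ on $G$ with $\nu(B+x)=0$ for all $x\in G$; non-shy means not shy. $C[0,1]$ is the Banach space of continuous functions $[0,1]\to\mathbb{R}$ with the maximum norm (an abelian Polish group under addition). A gauge function is a non-decreasing function $\varphi:[0,\infty)\to[0,\infty)$ with $\varphi(0)=0$. The $\varphi$-Hausdorff measure of a metric space $X$ is $\mathcal{H}^\varphi(X)=\lim_{\delta\to0+}\mathcal{H}^\varphi_\delta(X)$, where $\mathcal{H}^\varphi_\delta(X)=\inf\{\sum_{i=1}^\infty\varphi(\operatorname{diam}A_i): X\subset\bigcup_{i=1}^\infty A_i,\ \operatorname{diam}A_i\leq\delta\text{ for all }i\}$, with $\operatorname{diam}\emptyset=0$. *)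

theory Defs
  imports "HOL-Probability.Probability"
begin

section \<open>The Polish group \<open>C[0,1]\<close>\<close>

class compact_metric_space = metric_space +
  assumes compact_UNIV: "compact (UNIV :: 'a set)"

typedef unit_interval = "{0..1::real}"
  by auto

instantiation unit_interval :: metric_space
begin

definition dist_unit_interval :: "unit_interval \<Rightarrow> unit_interval \<Rightarrow> real" where
  "dist_unit_interval x y = dist (Rep_unit_interval x) (Rep_unit_interval y)"

definition uniformity_unit_interval :: "(unit_interval \<times> unit_interval) filter" where
  "uniformity_unit_interval = (INF e\<in>{0 <..}. principal {(x, y). dist x y < e})"

definition open_unit_interval :: "unit_interval set \<Rightarrow> bool" where
  "open_unit_interval U = (\<forall>x\<in>U. \<forall>\<^sub>F (x', y) in uniformity. x' = x \<longrightarrow> y \<in> U)"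

instance
proof
  fix x y z :: unit_interval
  show "dist x y = 0 \<longleftrightarrow> x = y"
    by (simp add: dist_unit_interval_def Rep_unit_interval_inject)
  show "dist x y \<le> dist x z + dist y z"
    unfolding dist_unit_interval_def by (rule dist_triangle2)
qed (rule uniformity_unit_interval_def open_unit_interval_def)+

end

instance unit_interval :: compact_metric_space
proof
  have "continuous_on {0..1} Abs_unit_interval"
    unfolding continuous_on_iff dist_unit_interval_def
    by (auto simp: Abs_unit_interval_inverse)
  then have "compact (Abs_unit_interval ` {0..1})"
    by (rule compact_continuous_image) simp
  moreover have "Abs_unit_interval ` {0..1} = UNIV"
    by (metis Rep_unit_interval Rep_unit_interval_inverse UNIV_eq_I image_eqI)
  ultimately show "compact (UNIV :: unit_interval set)"
    by simp
qed

lemma ex_countable_dense_imp_subbasis: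
  fixes D :: "'a::metric_space set"
  assumes D: "countable D" "\<And>x e. e > 0 \<Longrightarrow> \<exists>d\<in>D. dist x d < e"
  shows "\<exists>B::'a set set. countable B \<and> open = generate_topology B"
proof -
  let ?B = "(\<lambda>(d, n). ball d (1 / Suc n)) ` (D \<times> (UNIV :: nat set))"
  have "topological_basis ?B"
  proof (rule topological_basisI)
    fix U :: "'a set" and x
    assume "open U" "x \<in> U"
    then obtain e where e: "e > 0" "ball x e \<subseteq> U"
      by (meson openE)
    obtain n where n: "1 / Suc n < e / 2"
      using \<open>e > 0\<close> by (metis half_gt_zero nat_approx_posE)
    obtain d where d: "d \<in> D" "dist x d < 1 / Suc n"
      using D(2)[of "1 / Suc n" x] by auto
    have "ball d (1 / Suc n) \<subseteq> ball x e"
    proof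
      fix z assume "z \<in> ball d (1 / Suc n)"
      then have "dist x z < 1 / Suc n + 1 / Suc n"
        using d dist_triangle[of x z d] by simp
      then show "z \<in> ball x e"
        using n by simp
    qed
    then have "ball d (1 / Suc n) \<subseteq> U" "x \<in> ball d (1 / Suc n)"
      using e d by (auto simp: dist_commute)
    then show "\<exists>B'\<in>?B. x \<in> B' \<and> B' \<subseteq> U"
      using d(1) by (intro bexI[of _ "ball d (1 / Suc n)"]) force+
  qed auto
  moreover have "countable ?B"
    using D(1) by simp
  ultimately show ?thesis
    by (metis topological_basis_imp_subbasis)
qed

instance bcontfun :: (compact_metric_space, "{metric_space, second_countable_topology}")
  second_countable_topology
proof
  have "\<exists>F. finite F \<and> (UNIV :: 'a set) \<subseteq> (\<Union>p\<in>F. ball p (1 / Suc m))" for m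
  proof -
    have "\<exists>F. finite F \<and> F \<subseteq> (UNIV :: 'a set) \<and> UNIV \<subseteq> (\<Union>p\<in>F. ball p (1 / Suc m))"
      by (rule seq_compact_imp_totally_bounded[rule_format, OF compact_imp_seq_compact[OF compact_UNIV]])
        simp
    then show ?thesis
      by blast
  qed
  then obtain N :: "nat \<Rightarrow> 'a set"
    where N: "\<And>m. finite (N m)" "\<And>m. UNIV \<subseteq> (\<Union>p\<in>N m. ball p (1 / Suc m))"
    by metis
  obtain E :: "'b set" where E: "countable E" "\<And>U. open U \<Longrightarrow> U \<noteq> {} \<Longrightarrow> \<exists>d\<in>E. d \<in> U"
    using countable_dense_setE by blast
  define S :: "nat \<times> nat \<times> ('a \<Rightarrow> 'b) \<Rightarrow> ('a \<Rightarrow>\<^sub>C 'b) set" where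
    "S = (\<lambda>(k, m, g). {f. \<forall>p\<in>N m. \<forall>x\<in>ball p (1 / Suc m).
            dist (apply_bcontfun f x) (g p) < 1 / Suc k})"
  define I where "I = (SIGMA k:(UNIV :: nat set). SIGMA m:(UNIV :: nat set). N m \<rightarrow>\<^sub>E E)"
  define D where "D = (\<lambda>i. SOME f. f \<in> S i) ` I"
  have "countable D"
    unfolding D_def I_def using N(1) E(1) by (intro countable_image countable_SIGMA countable_PiE) auto
  moreover have "\<exists>d\<in>D. dist f d < e" if "e > 0" for f :: "'a \<Rightarrow>\<^sub>C 'b" and e :: real
  proof -
    obtain k where k: "1 / Suc k < e / 4"
      using \<open>e > 0\<close> by (metis divide_pos_pos nat_approx_posE zero_less_numeral)
    have "uniformly_continuous_on UNIV (apply_bcontfun f)"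
      by (intro compact_uniformly_continuous compact_UNIV) simp
    then obtain r where r: "r > 0"
      "\<And>x y. dist x y < r \<Longrightarrow> dist (apply_bcontfun f x) (apply_bcontfun f y) < 1 / (2 * Suc k)"
      by (rule uniformly_continuous_onE[of _ _ "1 / (2 * Suc k)"]) (auto simp: dist_commute)
    obtain m where m: "1 / Suc m < r"
      using \<open>r > 0\<close> by (metis nat_approx_posE)
    have "\<exists>q\<in>E. dist (apply_bcontfun f p) q < 1 / (2 * Suc k)" for p
      using E(2)[of "ball (apply_bcontfun f p) (1 / (2 * Suc k))"] by auto
    then obtain h where h: "\<And>p. h p \<in> E" "\<And>p. dist (apply_bcontfun f p) (h p) < 1 / (2 * Suc k)"
      by metis
    define g where "g = restrict h (N m)"
    have fS: "f \<in> S (k, m, g)"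
      unfolding S_def
    proof (clarsimp)
      fix p x assume "p \<in> N m" "dist p x < 1 / (1 + real m)"
      then have "dist (apply_bcontfun f x) (apply_bcontfun f p) < 1 / (2 * Suc k)"
        using r(2)[of x p] m by (simp add: dist_commute)
      with h(2)[of p] have "dist (apply_bcontfun f x) (h p) < 1 / (2 * Suc k) + 1 / (2 * Suc k)"
        using dist_triangle[of "apply_bcontfun f x" "h p" "apply_bcontfun f p"] by linarith
      then show "dist (apply_bcontfun f x) (g p) < 1 / (1 + real k)"
        using \<open>p \<in> N m\<close> by (simp add: g_def field_simps)
    qed
    define d where "d = (SOME f. f \<in> S (k, m, g))"
    have dS: "d \<in> S (k, m, g)"
      unfolding d_def using fS by (rule someI)
    have "(k, m, g) \<in> I"
      using h(1) by (auto simp: I_def g_def)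
    then have "d \<in> D"
      by (auto simp: D_def d_def)
    have "dist (apply_bcontfun f x) (apply_bcontfun d x) \<le> e / 2" for x
    proof -
      obtain p where p: "p \<in> N m" "x \<in> ball p (1 / Suc m)"
        using N(2)[of m] by blast
      have "dist (apply_bcontfun f x) (g p) < 1 / Suc k" "dist (apply_bcontfun d x) (g p) < 1 / Suc k"
        using fS dS p unfolding S_def by blast+
      then show ?thesis
        using k dist_triangle2[of "apply_bcontfun f x" "apply_bcontfun d x" "g p"] by linarith
    qed
    then have "dist f d \<le> e / 2"
      by (rule dist_bound)
    with \<open>d \<in> D\<close> \<open>e > 0\<close> show ?thesis
      by (intro bexI[of _ d]) auto
  qed
  ultimately show "\<exists>B::('a \<Rightarrow>\<^sub>C 'b) set set. countable B \<and> open = generate_topology B"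
    by (rule ex_countable_dense_imp_subbasis)
qed

instance bcontfun :: (compact_metric_space, polish_space) polish_space ..

text \<open>Every continuous function on a compact space is bounded, so this type consists of all
  continuous functions; its norm is the maximum norm.\<close>

type_synonym C01 = "unit_interval \<Rightarrow>\<^sub>C real"


section \<open>Shy sets\<close>

definition shy :: "'a::{topological_ab_group_add, polish_space} set \<Rightarrow> bool" where
  "shy A \<longleftrightarrow> (\<exists>B \<in> sets borel. A \<subseteq> B \<and>
     (\<exists>\<nu>. prob_space \<nu> \<and> sets \<nu> = sets borel \<and>
       (\<forall>x. emeasure \<nu> ((\<lambda>b. b + x) ` B) = 0)))"


section \<open>Hausdorff measures\<close>

definition gauge_function :: "(real \<Rightarrow> real) \<Rightarrow> bool" where
  "gauge_function \<phi> \<longleftrightarrow> (\<forall>r\<ge>0. \<phi> r \<ge> 0) \<and> mono_on {0..} \<phi> \<and> \<phi> 0 = 0"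

text \<open>The covering sets may stick out of \<open>X\<close>; as \<open>\<phi>\<close> is non-decreasing, intersecting them
  with \<open>X\<close> shows that the value depends on the metric space \<open>X\<close> only. Boundedness is required
  because \<^const>\<open>diameter\<close> is unspecified on unbounded sets.\<close>

definition hausdorff_premeasure :: "(real \<Rightarrow> real) \<Rightarrow> real \<Rightarrow> 'a::metric_space set \<Rightarrow> ennreal" where
  "hausdorff_premeasure \<phi> \<delta> X =
     (INF A \<in> {A :: nat \<Rightarrow> 'a set. X \<subseteq> (\<Union>i. A i) \<and> (\<forall>i. bounded (A i) \<and> diameter (A i) \<le> \<delta>)}.
        \<Sum>i. ennreal (\<phi> (diameter (A i))))"

definition hausdorff_measure :: "(real \<Rightarrow> real) \<Rightarrow> 'a::metric_space set \<Rightarrow> ennreal" where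
  "hausdorff_measure \<phi> X = Lim (at_right 0) (\<lambda>\<delta>. hausdorff_premeasure \<phi> \<delta> X)"

lemma hausdorff_premeasure_antimono:
  "\<delta> \<le> \<delta>' \<Longrightarrow> hausdorff_premeasure \<phi> \<delta>' X \<le> hausdorff_premeasure \<phi> \<delta> X"
  unfolding hausdorff_premeasure_def by (rule INF_superset_mono) (auto intro: order_trans)

lemma tendsto_hausdorff_measure:
  "((\<lambda>\<delta>. hausdorff_premeasure \<phi> \<delta> X) \<longlongrightarrow> hausdorff_measure \<phi> X) (at_right 0)"
proof -
  let ?H = "\<lambda>\<delta>. hausdorff_premeasure \<phi> \<delta> X"
  have "(?H \<longlongrightarrow> (SUP \<delta>\<in>{0<..}. ?H \<delta>)) (at_right 0)"
  proof (rule order_tendstoI)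
    fix a assume "a < (SUP \<delta>\<in>{0<..}. ?H \<delta>)"
    then obtain \<delta> where \<delta>: "\<delta> > 0" "a < ?H \<delta>"
      by (auto simp: less_SUP_iff)
    then have "\<forall>\<delta>'>0. \<delta>' < \<delta> \<longrightarrow> a < ?H \<delta>'"
      by (meson hausdorff_premeasure_antimono less_imp_le less_le_trans)
    with \<delta>(1) show "\<forall>\<^sub>F \<delta>' in at_right 0. a < ?H \<delta>'"
      unfolding eventually_at_right_field by blast
  next
    fix a assume a: "(SUP \<delta>\<in>{0<..}. ?H \<delta>) < a"
    have "?H \<delta> < a" if "\<delta> > 0" for \<delta>
      using SUP_upper[of \<delta> "{0<..}" ?H] that a by (simp add: le_less_trans)
    then show "\<forall>\<^sub>F \<delta> in at_right 0. ?H \<delta> < a"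
      by (intro eventually_at_rightI[of 0 1]) auto
  qed
  then show ?thesis
    unfolding hausdorff_measure_def by (metis tendsto_Lim trivial_limit_at_right_real)
qed

end

theory Submission
  imports Defs
begin

text \<open>A probability measure on \<open>C[0,1]\<close> is inner regular, so it suffices to translate an arbitrary
  compact set \<open>K\<close> of functions into the given set by a single function \<open>g\<close>. Since \<open>K\<close> is
  equicontinuous, one can take a sum of zigzags \<open>g(x) = \<Sum>\<^sub>n 2\<^sup>-\<^sup>n tri(x/p\<^sub>n)\<close> with periods \<open>p\<^sub>n\<close>
  decreasing so fast that, on the scale \<open>p\<^sub>n\<close>, both \<open>f \<in> K\<close> and the partial sum of \<open>g\<close> are almost
  constant compared to the amplitude \<open>2\<^sup>-\<^sup>n\<close> of the next summand. Call a rising half period of length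
  \<open>p\<^sub>n/2\<close> robust if the value \<open>y\<close> is well inside the range that the remaining sum can reach from
  there. A robust interval contains a run of at least \<open>p\<^sub>n/(32 p\<^sub>n\<^sub>+\<^sub>1)\<close> robust intervals of the next
  level, and every nested sequence of robust intervals shrinks to a point where \<open>f + g = y\<close>.
  The mass distribution \<open>w\<^sub>n = 32\<^sup>n p\<^sub>n\<close> on this Cantor set then bounds the cost of every cover
  of the level set from below, because \<open>\<phi>(r)/r\<close> tends to infinity and so \<open>\<phi>(s) \<ge> 4 \<cdot> 32\<^sup>n\<^sup>+\<^sup>1 s\<close>
  for \<open>s \<le> p\<^sub>n\<close> if \<open>p\<^sub>n\<close> is small enough.\<close>

section \<open>Triangle waves and separated intervals\<close>

definition tri :: "real \<Rightarrow> real" where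
  "tri t = 2 * \<bar>t - of_int (round t)\<bar>"

lemma tri_nonneg: "0 \<le> tri t"
  by (simp add: tri_def)

lemma tri_le_one: "tri t \<le> 1"
  using of_int_round_abs_le[of t] by (simp add: tri_def abs_minus_commute)

lemma tri_lipschitz: "\<bar>tri s - tri t\<bar> \<le> 2 * \<bar>s - t\<bar>"
proof -
  have "tri s \<le> tri t + 2 * \<bar>s - t\<bar>" for s t :: real
    using round_diff_minimal[of s "round t"] abs_triangle_ineq[of "s - t" "t - of_int (round t)"]
    unfolding tri_def by simp
  from this[of s t] this[of t s] show ?thesis
    by (simp add: abs_le_iff abs_minus_commute)
qed

lemma tri_ascending:
  assumes "0 \<le> u" "u \<le> 1 / 2"
  shows "tri (real k + u) = 2 * u"
proof (cases "u < 1 / 2")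
  case True
  then have "round (real k + u) = int k"
    using assms by (intro round_unique') auto
  then show ?thesis
    using assms by (simp add: tri_def)
next
  case False
  then have u: "u = 1 / 2"
    using assms by simp
  have "round (real k + u) = int k + 1"
    by (intro round_unique) (auto simp: u)
  then show ?thesis
    by (simp add: tri_def u)
qed

text \<open>All indices met lie between the two extreme ones, whose difference is at most
  \<open>s / q + 1 / 2\<close> because points of \<open>A\<close> are at most \<open>s\<close>
  apart. The bound drops below 2 once \<open>s < q / 2\<close>.\<close>

lemma card_separated_intervals_le:
  fixes A :: "real set" and C :: "nat set"
  assumes "finite C" and "0 < q" and "0 \<le> s"
    and A: "\<And>x z. x \<in> A \<Longrightarrow> z \<in> A \<Longrightarrow> \<bar>x - z\<bar> \<le> s"
  shows "real (card {j \<in> C. A \<inter> {real j * q .. real j * q + q / 2} \<noteq> {}}) \<le> s / q + 3 / 2"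
proof (cases "{j \<in> C. A \<inter> {real j * q .. real j * q + q / 2} \<noteq> {}} = {}")
  case True
  then have "card {j \<in> C. A \<inter> {real j * q .. real j * q + q / 2} \<noteq> {}} = 0"
    by (metis card.empty)
  moreover have "0 \<le> s / q"
    using assms by simp
  ultimately show ?thesis
    by simp
next
  case False
  define M where "M = {j \<in> C. A \<inter> {real j * q .. real j * q + q / 2} \<noteq> {}}"
  have fin: "finite M" and ne: "M \<noteq> {}"
    using assms False by (auto simp: M_def)
  have "Min M \<in> M" "Max M \<in> M"
    using fin ne by auto
  then obtain x z where "x \<in> A" "x \<le> real (Min M) * q + q / 2" "z \<in> A" "real (Max M) * q \<le> z"
    by (auto simp: M_def)
  with A[of z x] have "real (Max M) * q - real (Min M) * q \<le> s + q / 2"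
    by linarith
  then have "(real (Max M) - real (Min M)) * q \<le> (s / q + 1 / 2) * q"
    using \<open>0 < q\<close> by (simp add: algebra_simps)
  then have le: "real (Max M) - real (Min M) \<le> s / q + 1 / 2"
    using \<open>0 < q\<close> by simp
  have "M \<subseteq> {Min M..Max M}"
    using fin by auto
  then have "card M \<le> card {Min M..Max M}"
    by (intro card_mono) auto
  also have "\<dots> = Suc (Max M) - Min M"
    by simp
  finally have "card M \<le> Suc (Max M) - Min M" .
  moreover have "Min M \<le> Max M"
    using fin ne by simp
  ultimately have "real (card M) \<le> real (Max M) - real (Min M) + 1"
    by linarith
  with le show ?thesis
    unfolding M_def by linarith
qed

section \<open>The zigzag series and its partial sums\<close>

text \<open>Divisibility by 32 makes the share \<open>m n div 32\<close> of the children exact; the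
  lower bound makes \<open>4 / m n\<close> at most \<open>(1 / 2) ^ n / 32\<close>.\<close>

locale zigzag =
  fixes m :: "nat \<Rightarrow> nat"
  assumes dvd_m: "32 dvd m n" and m_ge: "2 ^ (n + 7) \<le> m n"
begin

text \<open>The denominators divide one another, so the grids of mesh \<open>p n\<close> refine each
  other and fit \<open>{0..1}\<close> exactly.\<close>

definition p :: "nat \<Rightarrow> real" where
  "p n = 1 / real (\<Prod>i\<le>n. m i)"

definition S :: "nat \<Rightarrow> real \<Rightarrow> real" where
  "S n x = (\<Sum>i<n. (1 / 2) ^ i * tri (x / p i))"

definition g :: "real \<Rightarrow> real" where
  "g x = (\<Sum>i. (1 / 2) ^ i * tri (x / p i))"

text \<open>Only the rising half of a period: there summand \<open>n\<close> of the series is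
  linear, from 0 to \<open>(1 / 2) ^ n\<close>.\<close>

definition J :: "nat \<Rightarrow> nat \<Rightarrow> real set" where
  "J n k = {real k * p n .. real k * p n + p n / 2}"

lemma m_pos: "0 < m n"
  using m_ge[of n] by (metis less_le_trans zero_less_numeral zero_less_power)

lemma p_pos: "0 < p n"
  using m_pos by (simp add: p_def prod_pos)

lemma p_Suc: "p n = real (m (Suc n)) * p (Suc n)"
  using m_pos[of "Suc n"] by (simp add: p_def)

lemma p_le: "p n \<le> 1 / real (m n)"
proof (cases n)
  case (Suc k)
  have "1 \<le> (\<Prod>i\<le>k. real (m i))"
    using m_pos by (intro prod_ge_1) (simp add: Suc_leI)
  then have "real (m n) \<le> (\<Prod>i\<le>n. real (m i))"
    using m_pos[of n] Suc by simp
  then show ?thesis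
    using m_pos[of n] by (auto simp: p_def intro!: divide_left_mono prod_pos m_pos)
qed (simp add: p_def)

lemma p_le_half_pow: "p n \<le> (1 / 2) ^ n"
proof -
  have "1 / real (m n) \<le> 1 / 2 ^ n"
  proof (rule divide_left_mono)
    have "(2::nat) ^ n \<le> 2 ^ (n + 7)"
      by (rule power_increasing) auto
    then have "2 ^ n \<le> m n"
      using m_ge[of n] by linarith
    then show "2 ^ n \<le> real (m n)"
      by (metis of_nat_le_iff of_nat_numeral of_nat_power)
  qed (use m_pos[of n] in auto)
  then show ?thesis
    using p_le[of n] by (simp add: power_one_over)
qed

lemma decseq_p: "decseq p"
proof (rule decseq_SucI)
  fix n
  show "p (Suc n) \<le> p n"
    using p_Suc[of n] p_pos[of "Suc n"] m_pos[of "Suc n"] by simp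
qed

lemma p_reciprocal: "\<exists>N>0. real N * p n = 1"
  using m_pos by (intro exI[of _ "\<Prod>i\<le>n. m i"]) (auto simp: p_def intro!: prod_pos)

lemma S_Suc: "S (Suc n) x = S n x + (1 / 2) ^ n * tri (x / p n)"
  by (simp add: S_def)

text \<open>All periods involved are at least \<open>p n\<close>, so summand \<open>i\<close> has
  slope at most \<open>(1 / 2) ^ i * 2 / p n\<close>, and the amplitudes add up to at most
  2.\<close>

lemma S_lipschitz: "\<bar>S (Suc n) x - S (Suc n) z\<bar> \<le> 4 * \<bar>x - z\<bar> / p n"
proof -
  have "\<bar>S (Suc n) x - S (Suc n) z\<bar> \<le> (\<Sum>i<Suc n. \<bar>(1 / 2) ^ i * tri (x / p i) - (1 / 2) ^ i * tri (z / p i)\<bar>)"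
    unfolding S_def sum_subtractf[symmetric] by (rule sum_abs)
  also have "\<dots> \<le> (\<Sum>i<Suc n. (1 / 2) ^ i * (2 * \<bar>x - z\<bar> / p n))"
  proof (rule sum_mono)
    fix i assume "i \<in> {..<Suc n}"
    then have "p n \<le> p i"
      using decseq_p by (auto simp: decseq_def)
    have "\<bar>tri (x / p i) - tri (z / p i)\<bar> \<le> 2 * \<bar>x / p i - z / p i\<bar>"
      by (rule tri_lipschitz)
    also have "\<dots> = 2 * \<bar>x - z\<bar> / p i"
      using p_pos[of i] by (simp add: diff_divide_distrib[symmetric])
    also have "\<dots> \<le> 2 * \<bar>x - z\<bar> / p n"
      using \<open>p n \<le> p i\<close> p_pos by (intro divide_left_mono) auto
    finally have "(1 / 2) ^ i * \<bar>tri (x / p i) - tri (z / p i)\<bar> \<le> (1 / 2) ^ i * (2 * \<bar>x - z\<bar> / p n)"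
      by (intro mult_left_mono) auto
    then show "\<bar>(1 / 2) ^ i * tri (x / p i) - (1 / 2) ^ i * tri (z / p i)\<bar> \<le> (1 / 2) ^ i * (2 * \<bar>x - z\<bar> / p n)"
      by (simp add: right_diff_distrib[symmetric] abs_mult)
  qed
  also have "\<dots> = (\<Sum>i<Suc n. (1 / 2) ^ i) * (2 * \<bar>x - z\<bar> / p n)"
    by (rule sum_distrib_right[symmetric])
  also have "\<dots> \<le> 2 * (2 * \<bar>x - z\<bar> / p n)"
  proof (rule mult_right_mono)
    show "(\<Sum>i<Suc n. (1 / 2 :: real) ^ i) \<le> 2"
      by (simp add: sum_gp_strict del: sum.lessThan_Suc)
  qed (use p_pos[of n] in auto)
  finally show ?thesis
    by simp
qed

text \<open>For positive \<open>n\<close> the shortest period in \<open>S n\<close> is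
  \<open>m n * p n\<close>, so the Lipschitz bound allows a change of at most
  \<open>4 / m n\<close>.\<close>

lemma S_oscillation:
  assumes "\<bar>x - z\<bar> \<le> p n"
  shows "\<bar>S n x - S n z\<bar> \<le> (1 / 2) ^ n / 32"
proof (cases n)
  case (Suc k)
  have "\<bar>S n x - S n z\<bar> \<le> 4 * \<bar>x - z\<bar> / p k"
    unfolding Suc by (rule S_lipschitz)
  also have "\<dots> \<le> 4 * p n / p k"
    using assms p_pos[of k] by (intro divide_right_mono) auto
  also have "\<dots> = 4 / real (m n)"
    using p_pos[of n] m_pos[of n] by (simp add: Suc p_Suc[of k])
  also have "\<dots> \<le> 4 / 2 ^ (n + 7)"
  proof (rule divide_left_mono)
    show "2 ^ (n + 7) \<le> real (m n)"
      using m_ge[of n] by (metis of_nat_le_iff of_nat_numeral of_nat_power)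
  qed (use m_pos[of n] in auto)
  also have "\<dots> = (1 / 2) ^ n / 32"
    by (simp add: power_add power_one_over)
  finally show ?thesis .
qed (simp add: S_def)

lemma summable_g: "summable (\<lambda>i. (1 / 2) ^ i * tri (x / p i))"
proof (rule summable_comparison_test)
  show "\<exists>N. \<forall>n\<ge>N. norm ((1 / 2) ^ n * tri (x / p n)) \<le> (1 / 2) ^ n"
    using tri_nonneg tri_le_one by (auto simp: abs_mult mult_left_le)
  show "summable (\<lambda>n. (1 / 2 :: real) ^ n)"
    by (rule summable_geometric) simp
qed

lemma g_tail_bounds: "S n x \<le> g x" "g x \<le> S n x + 2 * (1 / 2) ^ n"
proof -
  let ?a = "\<lambda>i. (1 / 2) ^ i * tri (x / p i)"
  have eq: "g x = (\<Sum>i. ?a (i + n)) + S n x"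
    unfolding g_def S_def by (rule suminf_split_initial_segment[OF summable_g])
  have sm: "summable (\<lambda>i. ?a (i + n))"
    by (rule summable_ignore_initial_segment[OF summable_g])
  have "0 \<le> (\<Sum>i. ?a (i + n))"
    by (rule suminf_nonneg[OF sm]) (simp add: tri_nonneg)
  then show "S n x \<le> g x"
    using eq by simp
  have gs: "(\<lambda>i. (1 / 2 :: real) ^ n * (1 / 2) ^ i) sums ((1 / 2) ^ n * 2)"
    using geometric_sums[of "1 / 2 :: real"] by (intro sums_mult) simp
  have "(\<Sum>i. ?a (i + n)) \<le> (\<Sum>i. (1 / 2 :: real) ^ n * (1 / 2) ^ i)"
    using tri_le_one by (intro suminf_le sm sums_summable[OF gs]) (simp add: power_add mult_left_le mult.commute)
  also have "\<dots> = (1 / 2) ^ n * 2"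
    using gs by (rule sums_unique[symmetric])
  finally show "g x \<le> S n x + 2 * (1 / 2) ^ n"
    using eq by simp
qed

lemma continuous_on_S: "continuous_on X (S n)"
proof (cases n)
  case (Suc k)
  have "(4 / p k)-lipschitz_on X (S n)"
    using S_lipschitz[of k] p_pos[of k]
    by (intro lipschitz_onI) (auto simp: Suc dist_real_def)
  then show ?thesis
    by (rule lipschitz_on_continuous_on)
qed (simp add: S_def[abs_def])

lemma continuous_on_g: "continuous_on X g"
proof (rule uniform_limit_theorem[where F = sequentially and f = S])
  have "uniform_limit X (\<lambda>n x. \<Sum>i<n. (1 / 2) ^ i * tri (x / p i)) (\<lambda>x. \<Sum>i. (1 / 2) ^ i * tri (x / p i)) sequentially"
    using tri_nonneg tri_le_one
    by (intro Weierstrass_m_test[where M = "\<lambda>n. (1 / 2) ^ n"]) (auto simp: abs_mult mult_left_le)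
  then show "uniform_limit X S g sequentially"
    by (simp add: S_def[abs_def] g_def[abs_def])
qed (auto simp: continuous_on_S)

end

section \<open>Robust intervals for a level of the perturbed series\<close>

text \<open>Here \<open>f\<close> stands for a member of the compact set, \<open>y\<close> for a
  level and \<open>\<psi>\<close> for a minorant of the gauge. In the growth bound,
  \<open>32 ^ Suc n\<close> is the density of the mass \<open>w (Suc n)\<close>, and 4 absorbs the
  number of children that a set meets.\<close>

locale zigzag_perturbed = zigzag +
  fixes f :: "real \<Rightarrow> real" and y :: real and \<psi> :: "real \<Rightarrow> real"
  assumes f_cont: "continuous_on {0..1} f"
    and f_osc: "x \<in> {0..1} \<Longrightarrow> z \<in> {0..1} \<Longrightarrow> \<bar>x - z\<bar> \<le> p n \<Longrightarrow> \<bar>f x - f z\<bar> \<le> (1 / 2) ^ n / 32"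
    and \<psi>_mono: "0 < s \<Longrightarrow> s \<le> t \<Longrightarrow> \<psi> s \<le> \<psi> t"
    and \<psi>_ge: "0 < s \<Longrightarrow> s \<le> p n \<Longrightarrow> 4 * 32 ^ Suc n * s \<le> \<psi> s"
begin

text \<open>Robustness: the tail of \<open>g\<close> from index \<open>n\<close> on vanishes at \<open>k p\<^sub>n\<close> and takes values in
  \<open>[0, 2\<^sup>1\<^sup>-\<^sup>n]\<close>; the missing height is required to lie in the middle half of \<open>[0, 2\<^sup>-\<^sup>n]\<close>.\<close>

definition R :: "nat \<Rightarrow> nat \<Rightarrow> bool" where
  "R n k \<longleftrightarrow> J n k \<subseteq> {0..1} \<and>
     \<bar>y - (f (real k * p n) + S n (real k * p n)) - (1 / 2) ^ n / 2\<bar> \<le> (1 / 2) ^ n / 4"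

text \<open>Along \<open>J n k\<close> the wave of index \<open>n\<close> gains height linearly, so
  the children at which the missing height is close to \<open>a / 4\<close>, the centre required at
  level \<open>Suc n\<close>, form a run. A slack of \<open>a / 16\<close> in height corresponds to
  one 32nd of the period.\<close>

lemma R_children:
  assumes "R n k"
  shows "\<exists>j0. \<forall>j\<in>{j0..<j0 + m (Suc n) div 32}. J (Suc n) j \<subseteq> J n k \<and> R (Suc n) j"
proof -
  define M where "M = m (Suc n) div 32"
  define q where "q = p (Suc n)"
  define a where "a = (1 / 2 :: real) ^ n"
  \<comment> \<open>The fraction of the amplitude \<open>a\<close> to be climbed until just
    \<open>a / 4\<close> is missing.\<close>
  define \<tau> where "\<tau> = (y - (f (real k * p n) + S n (real k * p n))) / a - 1 / 4"
  have mM: "m (Suc n) = 32 * M"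
    using dvd_m[of "Suc n"] by (simp add: M_def)
  have M1: "0 < M"
    using m_pos[of "Suc n"] by (simp add: mM)
  have a: "0 < a" and q: "0 < q"
    by (simp_all add: a_def q_def p_pos)
  have pq: "p n = 32 * real M * q"
    unfolding p_Suc[of n] q_def mM by simp
  have Jn: "J n k \<subseteq> {0..1}" and Rn: "\<bar>y - (f (real k * p n) + S n (real k * p n)) - a / 2\<bar> \<le> a / 4"
    using assms by (auto simp: R_def a_def)
  have y: "y - (f (real k * p n) + S n (real k * p n)) = a * (\<tau> + 1 / 4)"
    using a by (simp add: \<tau>_def)
  have "a * (\<tau> + 1 / 4) - a / 2 = a * (\<tau> - 1 / 4)"
    by (simp add: algebra_simps)
  then have "a * \<bar>\<tau> - 1 / 4\<bar> = \<bar>a * (\<tau> + 1 / 4) - a / 2\<bar>"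
    using a by (simp add: abs_mult)
  also have "\<dots> \<le> a * (1 / 4)"
    using Rn y by simp
  finally have "\<bar>\<tau> - 1 / 4\<bar> \<le> 1 / 4"
    using a by simp
  then have \<tau>: "0 \<le> \<tau>" "\<tau> \<le> 1 / 2"
    by linarith+
  \<comment> \<open>A half period holds \<open>16 * M\<close> steps of length \<open>q\<close>, so
    height \<open>a * \<tau>\<close> is gained after \<open>16 * M * \<tau>\<close> steps. Rounding
    up costs less than one step, which the half-open run of \<open>M\<close> indices
    absorbs.\<close>
  define i0 where "i0 = nat \<lceil>16 * real M * \<tau>\<rceil>"
  have i0: "16 * real M * \<tau> \<le> real i0" "real i0 < 16 * real M * \<tau> + 1"
    using \<tau> by (simp_all add: i0_def) linarith+
  have "J (Suc n) j \<subseteq> J n k \<and> R (Suc n) j" if "j \<in> {k * m (Suc n) + i0..<k * m (Suc n) + i0 + M}" for j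
  proof -
    define i where "i = j - k * m (Suc n)"
    have j: "j = k * m (Suc n) + i" and "i0 \<le> i" "i < i0 + M"
      using that by (auto simp: i_def)
    then have "real i0 \<le> real i" "real i + 1 \<le> real i0 + real M"
      by linarith+
    with i0 have i: "16 * real M * \<tau> \<le> real i" "real i \<le> 16 * real M * (\<tau> + 1 / 16)"
      by (simp_all add: algebra_simps)
    define u where "u = real i / (32 * real M)"
    have u: "\<tau> \<le> 2 * u" "2 * u \<le> \<tau> + 1 / 16"
      using i M1 by (simp_all add: u_def field_simps)
    have xj: "real j * q = real k * p n + real i * q"
      unfolding j pq mM by (simp add: algebra_simps)
    have iu: "real i * q = u * p n"
      using M1 by (simp add: u_def pq)
    have "16 * real M * (\<tau> + 1 / 16) \<le> 16 * real M * (9 / 16)"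
      using \<tau> by (intro mult_left_mono) auto
    with i have "real i \<le> 9 * real M"
      by linarith
    then have "real i + 1 / 2 \<le> 16 * real M"
      using M1 by linarith
    then have "(real i + 1 / 2) * q \<le> (16 * real M) * q"
      using q by (intro mult_right_mono) auto
    then have iq: "real i * q + q / 2 \<le> p n / 2"
      by (simp add: pq algebra_simps)
    have sub: "J (Suc n) j \<subseteq> J n k"
      using iq q unfolding J_def q_def[symmetric] xj by auto
    have x0: "real k * p n \<in> {0..1}"
      using Jn p_pos[of n] by (force simp: J_def)
    have x1: "real j * q \<in> {0..1}"
      using sub Jn q by (force simp: J_def q_def)
    have d: "\<bar>real j * q - real k * p n\<bar> \<le> p n"
      using iq q p_pos[of n] unfolding xj by simp
    have "real j * q / p n = real k + u"
      using p_pos[of n] unfolding xj iu by (simp add: field_simps)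
    moreover have "tri (real k + u) = 2 * u"
      using u \<tau> by (intro tri_ascending) auto
    ultimately have "S (Suc n) (real j * q) = S n (real j * q) + a * (2 * u)"
      by (simp add: S_Suc a_def)
    moreover have "\<bar>f (real j * q) - f (real k * p n)\<bar> \<le> a / 32"
      using f_osc[OF x1 x0 d] by (simp add: a_def)
    moreover have "\<bar>S n (real j * q) - S n (real k * p n)\<bar> \<le> a / 32"
      using S_oscillation[OF d] by (simp add: a_def)
    moreover have "a * \<tau> \<le> a * (2 * u)" "a * (2 * u) \<le> a * (\<tau> + 1 / 16)"
      using u a by (simp_all add: mult_left_mono)
    \<comment> \<open>The tolerance of level \<open>Suc n\<close> is \<open>a / 8\<close>: the
      position in the run takes \<open>a / 16\<close>, and \<open>f\<close> and \<open>S n\<close>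
      take \<open>a / 32\<close> each.\<close>
    ultimately have "\<bar>y - (f (real j * q) + S (Suc n) (real j * q)) - a / 4\<bar> \<le> a / 8"
      using y unfolding ring_distribs by linarith
    then have "R (Suc n) j"
      using sub Jn unfolding R_def q_def[symmetric] by (simp add: a_def)
    with sub show ?thesis
      by simp
  qed
  then show ?thesis
    unfolding M_def by blast
qed

lemma \<psi>_pos: "0 < s \<Longrightarrow> 0 < \<psi> s"
proof -
  assume s: "0 < s"
  define t where "t = min s (p 0)"
  have t: "0 < t" "t \<le> p 0" "t \<le> s"
    using s p_pos[of 0] by (auto simp: t_def)
  have "0 < 4 * 32 ^ Suc 0 * t"
    using t by simp
  also have "\<dots> \<le> \<psi> t"
    using t by (intro \<psi>_ge) auto
  also have "\<dots> \<le> \<psi> s"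
    using t by (intro \<psi>_mono)
  finally show ?thesis .
qed

section \<open>Mass distribution on the robust intervals\<close>

definition w :: "nat \<Rightarrow> real" where
  "w n = p n * 32 ^ n"

lemma w_pos: "0 < w n"
  by (simp add: w_def p_pos)

text \<open>Conservation of mass: a robust interval passes its mass on to one 32nd of its
  subintervals, so the density relative to length grows 32-fold per level.\<close>

lemma w_Suc: "w n = real (m (Suc n) div 32) * w (Suc n)"
proof -
  have "real (m (Suc n)) = 32 * real (m (Suc n) div 32)"
    using dvd_m[of "Suc n"] by (metis dvd_mult_div_cancel of_nat_mult of_nat_numeral)
  then show ?thesis
    by (simp add: w_def p_Suc[of n])
qed

text \<open>Short sets meet at most one child; for the others the growth of \<open>\<psi>\<close> beats the number of
  children that they meet.\<close>

lemma sum_capped_le: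
  assumes "finite C" "0 < s" and A: "\<And>x z. x \<in> A \<Longrightarrow> z \<in> A \<Longrightarrow> \<bar>x - z\<bar> \<le> s"
    and "\<psi> s < w n"
  shows "(\<Sum>j\<in>C. if A \<inter> J (Suc n) j \<noteq> {} then min (\<psi> s) (w (Suc n)) else 0) \<le> \<psi> s"
proof -
  define q where "q = p (Suc n)"
  define c where "c = real (card {j \<in> C. A \<inter> J (Suc n) j \<noteq> {}})"
  have q: "0 < q"
    by (simp add: q_def p_pos)
  have c: "c \<le> s / q + 3 / 2"
    unfolding c_def J_def q_def[symmetric] using assms q
    by (intro card_separated_intervals_le) auto
  have "(\<Sum>j\<in>C. if A \<inter> J (Suc n) j \<noteq> {} then min (\<psi> s) (w (Suc n)) else 0) = c * min (\<psi> s) (w (Suc n))"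
    using \<open>finite C\<close> by (subst sum.inter_filter[symmetric]) (auto simp: c_def)
  also have "\<dots> \<le> \<psi> s"
  proof (cases "s < q / 2")
    case True
    then have "s / q < 1 / 2"
      using q by (simp add: field_simps)
    with c have "c < 2"
      by linarith
    then have "c \<le> 1"
      by (simp add: c_def)
    have "c * min (\<psi> s) (w (Suc n)) \<le> 1 * \<psi> s"
      using \<open>c \<le> 1\<close> \<psi>_pos[OF \<open>0 < s\<close>] w_pos[of "Suc n"] by (intro mult_mono) auto
    then show ?thesis
      by simp
  next
    case False
    \<comment> \<open>A larger \<open>s\<close> would give
      \<open>\<psi> s \<ge> \<psi> (p n) \<ge> 128 * w n\<close>, against
      \<open>\<psi> s < w n\<close>.\<close>
    have "s \<le> p n"
    proof (rule ccontr)
      assume "\<not> s \<le> p n"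
      then have "\<psi> (p n) \<le> \<psi> s"
        using p_pos[of n] by (intro \<psi>_mono) auto
      moreover have "4 * 32 ^ Suc n * p n \<le> \<psi> (p n)"
        using p_pos[of n] by (intro \<psi>_ge) auto
      moreover have "1 * w n \<le> 128 * w n"
        using w_pos[of n] by (intro mult_right_mono) auto
      ultimately show False
        using \<open>\<psi> s < w n\<close> by (simp add: w_def mult.commute)
    qed
    have "1 / 2 \<le> s / q"
      using False q by (simp add: field_simps)
    \<comment> \<open>Here \<open>3 / 2\<close> is at most \<open>3 * (s / q)\<close>; this is where
      the 4 in the growth bound comes from.\<close>
    with c have "c \<le> 4 * (s / q)"
      by linarith
    have "c * min (\<psi> s) (w (Suc n)) \<le> (4 * (s / q)) * w (Suc n)"
      using \<open>c \<le> 4 * (s / q)\<close> w_pos[of "Suc n"] \<psi>_pos[OF \<open>0 < s\<close>] \<open>0 < s\<close> q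
      by (intro mult_mono) auto
    also have "\<dots> = 4 * 32 ^ Suc n * s"
      using q by (simp add: w_def q_def[symmetric])
    also have "\<dots> \<le> \<psi> s"
      using \<open>0 < s\<close> \<open>s \<le> p n\<close> by (rule \<psi>_ge)
    finally show ?thesis .
  qed
  finally show ?thesis .
qed

text \<open>If all children cost at least \<open>w (Suc n)\<close>, so they do with weights capped at that value, and
  summing over the children contradicts the capped estimate.\<close>

lemma cheap_child:
  fixes A :: "nat \<Rightarrow> real set" and s :: "nat \<Rightarrow> real"
  defines "cost \<equiv> \<lambda>n k. \<Sum>i. ennreal (if A i \<inter> J n k \<noteq> {} then \<psi> (s i) else 0)"
  assumes s: "\<And>i. 0 < s i" and A: "\<And>i x z. x \<in> A i \<Longrightarrow> z \<in> A i \<Longrightarrow> \<bar>x - z\<bar> \<le> s i"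
    and "R n k" and cost: "cost n k < ennreal (w n)"
  shows "\<exists>j. J (Suc n) j \<subseteq> J n k \<and> R (Suc n) j \<and> cost (Suc n) j < ennreal (w (Suc n))"
proof -
  define M where "M = m (Suc n) div 32"
  obtain j0 where j0: "\<And>j. j \<in> {j0..<j0 + M} \<Longrightarrow> J (Suc n) j \<subseteq> J n k \<and> R (Suc n) j"
    using R_children[OF \<open>R n k\<close>] unfolding M_def by blast
  define C where "C = {j0..<j0 + M}"
  define u where "u i j = (if A i \<inter> J (Suc n) j \<noteq> {} then min (\<psi> (s i)) (w (Suc n)) else 0)" for i j
  have u0: "0 \<le> u i j" for i j
    using \<psi>_pos[OF s[of i]] w_pos[of "Suc n"] by (auto simp: u_def)
  have "\<exists>j\<in>C. (\<Sum>i. ennreal (u i j)) < ennreal (w (Suc n))"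
  proof (rule ccontr)
    assume "\<not> ?thesis"
    then have *: "ennreal (w (Suc n)) \<le> (\<Sum>i. ennreal (u i j))" if "j \<in> C" for j
      using that by (meson not_less)
    have "ennreal (w n) = (\<Sum>j\<in>C. ennreal (w (Suc n)))"
      using w_pos[of "Suc n"] w_Suc[of n]
      by (simp add: C_def M_def ennreal_mult ennreal_of_nat_eq_real_of_nat)
    also have "\<dots> \<le> (\<Sum>j\<in>C. \<Sum>i. ennreal (u i j))"
      by (intro sum_mono *)
    also have "\<dots> = (\<Sum>i. \<Sum>j\<in>C. ennreal (u i j))"
      by (rule suminf_sum[symmetric]) simp
    also have "\<dots> \<le> cost n k"
      unfolding cost_def
    proof (rule suminf_le)
      fix i
      let ?t = "if A i \<inter> J n k \<noteq> {} then \<psi> (s i) else 0"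
      have "(\<Sum>j\<in>C. u i j) \<le> ?t"
      proof (cases "A i \<inter> J n k = {}")
        case True
        have "u i j = 0" if "j \<in> C" for j
          using j0[of j] that True by (auto simp: u_def C_def)
        then show ?thesis
          using True by simp
      next
        case False
        have "ennreal (\<psi> (s i)) \<le> cost n k"
          unfolding cost_def using False
          sum_le_suminf[of "\<lambda>i. ennreal (if A i \<inter> J n k \<noteq> {} then \<psi> (s i) else 0)" "{i}"] by simp
        with cost have "\<psi> (s i) < w n"
          using \<psi>_pos[OF s[of i]] by (metis ennreal_less_iff le_less_trans less_imp_le)
        then show ?thesis
          unfolding u_def using False s[of i] A[of _ i] by (simp add: sum_capped_le C_def)
      qed
      moreover have "(\<Sum>j\<in>C. ennreal (u i j)) = ennreal (\<Sum>j\<in>C. u i j)"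
        using u0 by (rule sum_ennreal)
      ultimately show "(\<Sum>j\<in>C. ennreal (u i j)) \<le> ennreal ?t"
        by (simp only: ennreal_leI)
    qed auto
    finally show False
      using cost by simp
  qed
  then obtain j where j: "j \<in> C" and uj: "(\<Sum>i. ennreal (u i j)) < ennreal (w (Suc n))"
    by blast
  \<comment> \<open>Every term of a sum below the cap is itself below the cap, so the cap is
    inactive for this child and the sum is its true cost.\<close>
  have "u i j = (if A i \<inter> J (Suc n) j \<noteq> {} then \<psi> (s i) else 0)" for i
  proof -
    have "ennreal (u i j) \<le> (\<Sum>i. ennreal (u i j))"
      using sum_le_suminf[of "\<lambda>i. ennreal (u i j)" "{i}"] by simp
    with uj have "u i j < w (Suc n)"
      using u0[of i j] by (metis ennreal_less_iff le_less_trans)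
    then show ?thesis
      by (auto simp: u_def min_def split: if_splits)
  qed
  with uj have "cost (Suc n) j < ennreal (w (Suc n))"
    by (simp add: cost_def)
  with j j0[of j] show ?thesis
    unfolding C_def by blast
qed

text \<open>Too cheap a cover would allow an endless descent through cheap robust intervals. Their
  common point is on the level set, hence in some \<open>A i\<close>, which then meets every
  interval of the chain. So \<open>\<psi> (s i)\<close> is at most each mass of the chain, while the
  growth bound puts it far above the mass at scales finer than \<open>s i\<close>.\<close>

lemma level_set_cover_sum_ge:
  fixes A :: "nat \<Rightarrow> real set" and s :: "nat \<Rightarrow> real"
  assumes s: "\<And>i. 0 < s i" and A: "\<And>i x z. x \<in> A i \<Longrightarrow> z \<in> A i \<Longrightarrow> \<bar>x - z\<bar> \<le> s i"
    and cover: "{x \<in> {0..1}. f x + g x = y} \<subseteq> (\<Union>i. A i)"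
    and "R n k"
  shows "ennreal (w n) \<le> (\<Sum>i. ennreal (\<psi> (s i)))"
proof (rule ccontr)
  define cost where "cost n k = (\<Sum>i. ennreal (if A i \<inter> J n k \<noteq> {} then \<psi> (s i) else 0))" for n k
  assume "\<not> ennreal (w n) \<le> (\<Sum>i. ennreal (\<psi> (s i)))"
  moreover have "cost n k \<le> (\<Sum>i. ennreal (\<psi> (s i)))"
    unfolding cost_def by (intro suminf_le) auto
  ultimately have start: "cost n k < ennreal (w n)"
    by simp
  have "\<exists>\<kappa>. \<forall>l. (R (n + l) (\<kappa> l) \<and> cost (n + l) (\<kappa> l) < ennreal (w (n + l)))
      \<and> J (n + Suc l) (\<kappa> (Suc l)) \<subseteq> J (n + l) (\<kappa> l)"
  proof (rule dependent_nat_choice)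
    show "\<exists>k. R (n + 0) k \<and> cost (n + 0) k < ennreal (w (n + 0))"
      using start \<open>R n k\<close> by auto
    show "\<exists>j. (R (n + Suc l) j \<and> cost (n + Suc l) j < ennreal (w (n + Suc l))) \<and>
        J (n + Suc l) j \<subseteq> J (n + l) k"
      if "R (n + l) k \<and> cost (n + l) k < ennreal (w (n + l))" for k l
      using cheap_child[of s A "n + l" k] s A that unfolding cost_def by auto
  qed
  then obtain \<kappa> where \<kappa>: "\<And>l. R (n + l) (\<kappa> l)" "\<And>l. cost (n + l) (\<kappa> l) < ennreal (w (n + l))"
    "\<And>l. J (n + Suc l) (\<kappa> (Suc l)) \<subseteq> J (n + l) (\<kappa> l)"
    by blast
  have "decseq (\<lambda>l. J (n + l) (\<kappa> l))"
    using \<kappa>(3) by (rule decseq_SucI)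
  have "(\<Inter>l. J (n + l) (\<kappa> l)) \<noteq> {}"
  proof (rule compact_nest)
    show "compact (J (n + l) (\<kappa> l))" "J (n + l) (\<kappa> l) \<noteq> {}" for l
      using p_pos[of "n + l"] by (auto simp: J_def)
    show "J (n + l') (\<kappa> l') \<subseteq> J (n + l) (\<kappa> l)" if "l \<le> l'" for l l'
      using \<open>decseq (\<lambda>l. J (n + l) (\<kappa> l))\<close> that by (auto simp: decseq_def)
  qed
  then obtain x where x: "\<And>l. x \<in> J (n + l) (\<kappa> l)"
    by blast
  have x01: "x \<in> {0..1}"
    using x[of 0] \<kappa>(1)[of 0] by (auto simp: R_def)
  have close: "\<bar>f x + g x - y\<bar> \<le> 4 * (1 / 2) ^ l" for l
  proof -
    define N where "N = n + l"
    define z where "z = real (\<kappa> l) * p N"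
    define a where "a = (1 / 2 :: real) ^ N"
    have z: "z \<in> {0..1}" and R: "\<bar>y - (f z + S N z) - a / 2\<bar> \<le> a / 4"
      using \<kappa>(1)[of l] p_pos[of N] by (force simp: R_def N_def z_def J_def a_def)+
    have d: "\<bar>x - z\<bar> \<le> p N"
      using x[of l] p_pos[of N] by (auto simp: J_def N_def z_def)
    have "\<bar>f x - f z\<bar> \<le> a / 32" "\<bar>S N x - S N z\<bar> \<le> a / 32"
      using f_osc[OF x01 z d] S_oscillation[OF d] by (simp_all add: a_def)
    moreover have "S N x \<le> g x" "g x \<le> S N x + 2 * a"
      using g_tail_bounds[where n = N and x = x] by (simp_all add: a_def)
    ultimately have "\<bar>f x + g x - y\<bar> \<le> 4 * a"
      using R by linarith
    also have "a \<le> (1 / 2) ^ l"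
      unfolding a_def N_def by (rule power_decreasing) auto
    finally show ?thesis
      by simp
  qed
  have "(\<lambda>l. 4 * (1 / 2 :: real) ^ l) \<longlonglongrightarrow> 4 * 0"
    by (intro tendsto_mult tendsto_const LIMSEQ_power_zero) simp
  then have "\<bar>f x + g x - y\<bar> \<le> 4 * 0"
    by (rule tendsto_lowerbound) (use close in auto)
  then have "x \<in> {x \<in> {0..1}. f x + g x = y}"
    using x01 by simp
  then obtain i where "x \<in> A i"
    using cover by blast
  have "ennreal (\<psi> (s i)) \<le> ennreal (w (n + l))" for l
  proof -
    have "A i \<inter> J (n + l) (\<kappa> l) \<noteq> {}"
      using \<open>x \<in> A i\<close> x[of l] by blast
    then have "ennreal (\<psi> (s i)) \<le> cost (n + l) (\<kappa> l)"
      unfolding cost_def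
      using sum_le_suminf[of "\<lambda>i. ennreal (if A i \<inter> J (n + l) (\<kappa> l) \<noteq> {} then \<psi> (s i) else 0)" "{i}"] by simp
    then show ?thesis
      using \<kappa>(2)[of l] by simp
  qed
  then have le: "\<psi> (s i) \<le> w (n + l)" for l
    using w_pos[of "n + l"] by (metis ennreal_le_iff less_imp_le)
  have "p \<longlonglongrightarrow> 0"
    by (rule tendsto_sandwich[OF _ _ tendsto_const LIMSEQ_power_zero[of "1 / 2 :: real"]])
      (auto simp: p_le_half_pow p_pos less_imp_le)
  then have "\<forall>\<^sub>F l in sequentially. p l < s i"
    using s[of i] by (rule order_tendstoD)
  then obtain N where N: "\<And>l. N \<le> l \<Longrightarrow> p l < s i"
    by (auto simp: eventually_sequentially)
  \<comment> \<open>This level belongs to the chain and also satisfies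
    \<open>p l < s i\<close>.\<close>
  define l where "l = n + N"
  have "4 * 32 ^ Suc l * p l \<le> \<psi> (p l)"
    using p_pos[of l] by (intro \<psi>_ge) auto
  also have "\<dots> \<le> \<psi> (s i)"
    using p_pos[of l] N[of l] by (intro \<psi>_mono) (auto simp: l_def)
  also have "\<dots> \<le> w l"
    using le[of N] by (simp add: l_def)
  finally have "128 * w l \<le> w l"
    by (simp add: w_def mult_ac)
  then show False
    using w_pos[of l] by linarith
qed

text \<open>Once the amplitude \<open>a\<close> is small, the partial sum crosses
  \<open>y - a / 2\<close> between \<open>u\<close> and \<open>v\<close>; the oscillation bounds
  carry this value to a grid point within \<open>p n\<close>, with an error of at most
  \<open>a / 16\<close>.\<close>

lemma ex_R:
  assumes "u \<in> {0..1}" "v \<in> {0..1}" "f u + g u < y" "y < f v + g v"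
  shows "\<exists>n k. R n k"
proof -
  have "(\<lambda>n. (1 / 2 :: real) ^ n) \<longlonglongrightarrow> 0"
    by (intro LIMSEQ_power_zero) simp
  \<comment> \<open>At \<open>v\<close> the partial sum may fall short of \<open>g\<close> by twice
    the amplitude, hence the divisor 3; at \<open>u\<close> it does not exceed
    \<open>g\<close>.\<close>
  moreover define e where "e = min (y - (f u + g u)) ((f v + g v - y) / 3)"
  moreover have "0 < e"
    using assms by (simp add: e_def)
  ultimately have "\<forall>\<^sub>F n in sequentially. (1 / 2 :: real) ^ n < e"
    by (metis order_tendstoD(2))
  then obtain n where n: "(1 / 2 :: real) ^ n < e"
    by (auto simp: eventually_sequentially)
  define a where "a = (1 / 2 :: real) ^ n"
  have a: "0 < a" "a < y - (f u + g u)" "3 * a < f v + g v - y"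
    using n by (simp_all add: a_def e_def)
  define F where "F x = f x + S n x" for x
  have "F u \<le> y - a / 2" "y - a / 2 \<le> F v"
    using a g_tail_bounds[where n = n and x = u] g_tail_bounds[where n = n and x = v] by (simp_all add: F_def a_def)
  moreover have "continuous_on {0..1} F"
    unfolding F_def by (intro continuous_intros f_cont continuous_on_S)
  then have "connected (F ` {0..1})"
    by (intro connected_continuous_image) auto
  ultimately have "y - a / 2 \<in> F ` {0..1}"
    using assms(1,2) by (meson connectedD_interval imageI)
  then obtain x where x: "x \<in> {0..1}" "F x = y - a / 2"
    by auto
  obtain N where N: "N > 0" "real N * p n = 1"
    using p_reciprocal[of n] by (metis of_nat_0_less_iff)
  \<comment> \<open>The cap \<open>N - 1\<close> serves \<open>x = 1\<close>, whose own index
    \<open>N\<close> would give an interval leaving \<open>{0..1}\<close>.\<close>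
  define k where "k = min (nat \<lfloor>real N * x\<rfloor>) (N - 1)"
  have "k + 1 \<le> N"
    using N(1) by (simp add: k_def)
  then have "(real k + 1) * p n \<le> real N * p n"
    using p_pos[of n] by (intro mult_right_mono) auto
  then have k1: "real k * p n + p n \<le> 1"
    using N(2) by (simp add: algebra_simps)
  have "real k \<le> real N * x \<and> real N * x \<le> real k + 1"
  proof (cases "x < 1")
    case True
    then have "real N * x < real N"
      using N(1) by simp
    then have "nat \<lfloor>real N * x\<rfloor> < N"
      using x(1) by (simp add: nat_less_iff floor_less_iff)
    then have "k = nat \<lfloor>real N * x\<rfloor>"
      by (simp add: k_def)
    then show ?thesis
      using x(1) by simp
  next
    case False
    then have "x = 1"
      using x(1) by simp
    then show ?thesis
      using N(1) by (simp add: k_def)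
  qed
  then have "real k * p n \<le> real N * x * p n \<and> real N * x * p n \<le> (real k + 1) * p n"
    using p_pos[of n] by (auto intro!: mult_right_mono)
  moreover have "real N * x * p n = x"
    using N(2) by (metis mult.commute mult.assoc mult_1)
  ultimately have xk: "real k * p n \<le> x" "x \<le> real k * p n + p n"
    by (auto simp: algebra_simps)
  have k0: "0 \<le> real k * p n"
    using p_pos[of n] by simp
  have z: "real k * p n \<in> {0..1}" and d: "\<bar>x - real k * p n\<bar> \<le> p n"
    using xk k1 k0 p_pos[of n] by auto
  have "\<bar>f x - f (real k * p n)\<bar> \<le> a / 32" "\<bar>S n x - S n (real k * p n)\<bar> \<le> a / 32"
    using f_osc[OF x(1) z d] S_oscillation[OF d] by (simp_all add: a_def)
  then have "\<bar>y - (f (real k * p n) + S n (real k * p n)) - a / 2\<bar> \<le> a / 4"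
    using x(2) a(1) unfolding F_def by linarith
  moreover have "J n k \<subseteq> {0..1}"
    using k0 k1 p_pos[of n] unfolding J_def by auto
  ultimately show ?thesis
    unfolding R_def a_def by blast
qed

end

section \<open>Lower bounds for Hausdorff measures\<close>

text \<open>A bound valid for all covers, whatever their mesh, survives the limit. Sizes
  \<open>s\<close> replace diameters because they can be kept positive; sets of diameter 0 may be
  free in the Hausdorff sum, and allowing for them costs half of \<open>c\<close>.\<close>

lemma hausdorff_measure_posI:
  fixes L :: "'a::metric_space set"
  assumes "0 < c"
    and \<psi>: "\<And>s. 0 < s \<Longrightarrow> 0 \<le> \<psi> s \<and> \<psi> s \<le> \<phi> s \<and> \<psi> s \<le> sqrt s"
    and cover: "\<And>(A :: nat \<Rightarrow> 'a set) s. (\<And>i. 0 < s i) \<Longrightarrow>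
      (\<And>i x z. x \<in> A i \<Longrightarrow> z \<in> A i \<Longrightarrow> dist x z \<le> s i) \<Longrightarrow>
      L \<subseteq> (\<Union>i. A i) \<Longrightarrow> ennreal c \<le> (\<Sum>i. ennreal (\<psi> (s i)))"
  shows "0 < hausdorff_measure \<phi> L"
proof -
  have "ennreal (c / 2) \<le> (\<Sum>i. ennreal (\<phi> (diameter (A i))))"
    if "L \<subseteq> (\<Union>i. A i)" and bdd: "\<And>i. bounded (A i)" for A :: "nat \<Rightarrow> 'a set"
  proof -
    define b where "b i = c / 4 * (1 / 2) ^ i" for i :: nat
    have b: "0 < b i" for i
      using \<open>0 < c\<close> by (simp add: b_def)
    have "b sums (c / 4 * 2)"
      unfolding b_def using geometric_sums[of "1 / 2 :: real"] by (intro sums_mult) simp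
    then have "(\<Sum>i. ennreal (b i)) = ennreal (c / 2)"
      using b by (intro suminf_ennreal_eq) (auto simp: less_imp_le)
    \<comment> \<open>Sets of diameter \<open>0\<close> cost nothing in the Hausdorff sum; they get sizes with total
      weight at most \<open>c / 2\<close>, which is possible because \<open>\<psi> s \<le> sqrt s\<close>.\<close>
    define s where "s i = (if 0 < diameter (A i) then diameter (A i) else (b i)\<^sup>2)" for i
    have s: "0 < s i" for i
      using b[of i] by (simp add: s_def)
    have "dist x z \<le> s i" if "x \<in> A i" "z \<in> A i" for i x z
    proof (cases "0 < diameter (A i)")
      case False
      then have "dist x z \<le> 0"
        using diameter_bounded_bound[OF bdd that] by linarith
      then show ?thesis
        using s[of i] by linarith
    qed (use diameter_bounded_bound[OF bdd that] in \<open>simp add: s_def\<close>)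
    then have "ennreal c \<le> (\<Sum>i. ennreal (\<psi> (s i)))"
      using s that(1) by (intro cover) auto
    also have "\<dots> \<le> (\<Sum>i. ennreal (\<phi> (diameter (A i))) + ennreal (b i))"
    proof (intro suminf_le)
      fix i
      show "ennreal (\<psi> (s i)) \<le> ennreal (\<phi> (diameter (A i))) + ennreal (b i)"
      proof (cases "0 < diameter (A i)")
        case True
        then have "ennreal (\<psi> (s i)) \<le> ennreal (\<phi> (diameter (A i)))"
          using \<psi>[OF s[of i]] by (simp add: s_def ennreal_leI)
        then show ?thesis
          by (metis add.right_neutral add_mono zero_le)
      next
        case False
        then have "ennreal (\<psi> (s i)) \<le> ennreal (b i)"
          using \<psi>[OF s[of i]] b[of i] by (intro ennreal_leI) (simp add: s_def)
        then show ?thesis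
          by (metis add.left_neutral add_mono zero_le)
      qed
    qed auto
    also have "\<dots> = (\<Sum>i. ennreal (\<phi> (diameter (A i)))) + ennreal (c / 2)"
      using \<open>(\<Sum>i. ennreal (b i)) = ennreal (c / 2)\<close> by (simp add: suminf_add[symmetric])
    finally have "ennreal c \<le> (\<Sum>i. ennreal (\<phi> (diameter (A i)))) + ennreal (c / 2)" .
    moreover have "ennreal c = ennreal (c / 2) + ennreal (c / 2)"
      using \<open>0 < c\<close> by (simp flip: ennreal_plus)
    ultimately show ?thesis
      by (simp add: add.commute)
  qed
  then have "ennreal (c / 2) \<le> hausdorff_premeasure \<phi> \<delta> L" for \<delta>
    unfolding hausdorff_premeasure_def by (intro INF_greatest) auto
  then have "ennreal (c / 2) \<le> hausdorff_measure \<phi> L"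
    by (intro tendsto_lowerbound[OF tendsto_hausdorff_measure]) auto
  then show ?thesis
    using \<open>0 < c\<close> by (metis ennreal_less_zero_iff half_gt_zero less_le_trans)
qed

section \<open>Translating compact sets of functions\<close>

text \<open>The easy half of Arzela-Ascoli: a finite \<open>e / 3\<close>-net consists of uniformly
  continuous functions.\<close>

lemma compact_bcontfun_equicontinuous:
  fixes K :: "('a::compact_metric_space \<Rightarrow>\<^sub>C 'b::metric_space) set"
  assumes "compact K" "0 < e"
  obtains d where "0 < d"
    "\<And>f x z. f \<in> K \<Longrightarrow> dist x z < d \<Longrightarrow> dist (apply_bcontfun f x) (apply_bcontfun f z) < e"
proof -
  obtain T where T: "finite T" "K \<subseteq> (\<Union>f\<in>T. ball f (e / 3))"
    using seq_compact_imp_totally_bounded[OF compact_imp_seq_compact[OF \<open>compact K\<close>]] \<open>0 < e\<close>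
    by (meson divide_pos_pos zero_less_numeral)
  have "\<exists>d>0. \<forall>x z. dist x z < d \<longrightarrow> dist (apply_bcontfun f x) (apply_bcontfun f z) < e / 3"
    for f :: "'a \<Rightarrow>\<^sub>C 'b"
  proof -
    have "uniformly_continuous_on UNIV (apply_bcontfun f)"
      by (intro compact_uniformly_continuous compact_UNIV) simp
    then show ?thesis
      using \<open>0 < e\<close> unfolding uniformly_continuous_on_def
      by (metis UNIV_I dist_commute divide_pos_pos zero_less_numeral)
  qed
  then obtain r where r: "\<And>f :: 'a \<Rightarrow>\<^sub>C 'b. 0 < r f"
    "\<And>(f :: 'a \<Rightarrow>\<^sub>C 'b) x z. dist x z < r f \<Longrightarrow> dist (apply_bcontfun f x) (apply_bcontfun f z) < e / 3"
    by metis
  define d where "d = Min (insert 1 (r ` T))"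
  have "0 < d"
    using T(1) r(1) by (auto simp: d_def)
  moreover have "dist (apply_bcontfun f x) (apply_bcontfun f z) < e" if "f \<in> K" "dist x z < d" for f x z
  proof -
    obtain t where t: "t \<in> T" "dist t f < e / 3"
      using T(2) \<open>f \<in> K\<close> by auto
    have "d \<le> r t"
      using T(1) t(1) by (auto simp: d_def)
    then have "dist (apply_bcontfun t x) (apply_bcontfun t z) < e / 3"
      using that(2) by (intro r(2)) simp
    moreover have "dist (apply_bcontfun t x) (apply_bcontfun f x) < e / 3"
      "dist (apply_bcontfun t z) (apply_bcontfun f z) < e / 3"
      using t(2) dist_bounded[of t] by (metis le_less_trans)+
    ultimately show ?thesis
      using dist_triangle3[of "apply_bcontfun f x" "apply_bcontfun f z" "apply_bcontfun t x"]
        dist_triangle[of "apply_bcontfun t x" "apply_bcontfun f z" "apply_bcontfun t z"]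
      by linarith
  qed
  ultimately show ?thesis
    by (rule that)
qed

text \<open>Since \<open>p n \<le> 1 / m n\<close>, each factor can be chosen from
  \<open>\<delta> n\<close> alone, without recursion on earlier periods.\<close>

lemma ex_zigzag:
  assumes "\<And>n. 0 < (\<delta> n :: real)"
  obtains m where "zigzag m" "\<And>n. zigzag.p m n \<le> \<delta> n"
proof -
  define m where "m n = 32 * 2 ^ (n + 7) * Suc (nat \<lceil>1 / \<delta> n\<rceil>)" for n
  interpret zigzag m
  proof
    show "32 dvd m n" for n
      by (simp add: m_def mult.assoc)
    show "2 ^ (n + 7) \<le> m n" for n
      by (simp add: m_def)
  qed
  have "p n \<le> \<delta> n" for n
  proof -
    have "1 \<le> (32 * 2 ^ (n + 7) :: nat)"
      by simp
    then have "1 * Suc (nat \<lceil>1 / \<delta> n\<rceil>) \<le> m n"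
      unfolding m_def by (rule mult_le_mono1)
    then have "real (nat \<lceil>1 / \<delta> n\<rceil>) \<le> real (m n)"
      unfolding mult_1 by (rule of_nat_mono[OF Suc_leD])
    then have "1 / \<delta> n \<le> real (m n)"
      by (rule order_trans[OF real_nat_ceiling_ge])
    then have "1 / real (m n) \<le> \<delta> n"
      using assms[of n] m_pos[of n] by (simp add: field_simps)
    with p_le[of n] show ?thesis
      by linarith
  qed
  then show ?thesis
    using zigzag_axioms by (rule that[rotated])
qed

text \<open>The periods are chosen from a modulus of continuity common to all of \<open>K\<close>
  and from the growth of \<open>\<phi>\<close>, so a single \<open>G\<close> serves every
  \<open>f\<close> and \<open>y\<close>.\<close>

lemma ex_translate_of_compact:
  fixes K :: "C01 set"
  assumes gauge: "gauge_function \<phi>"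
    and lim: "filterlim (\<lambda>r. \<phi> r / r) at_top (at_right 0)"
    and "compact K"
  obtains G :: C01 where "\<And>f y. f \<in> K \<Longrightarrow>
      y \<in> {(INF x. apply_bcontfun (f + G) x)<..<(SUP x. apply_bcontfun (f + G) x)} \<Longrightarrow>
      0 < hausdorff_measure \<phi> (apply_bcontfun (f + G) -` {y})"
proof -
  \<comment> \<open>Capping by the square root keeps monotonicity and superlinear growth near 0, and
    makes \<open>\<psi>\<close> tend to 0 there, which a gauge function need not do.\<close>
  define \<psi> where "\<psi> s = min (\<phi> s) (sqrt s)" for s
  have \<psi>_mono: "\<psi> s \<le> \<psi> t" if "0 < s" "s \<le> t" for s t
  proof -
    have "\<phi> s \<le> \<phi> t"
      using gauge that mono_onD[of "{0..}" \<phi> s t] by (simp add: gauge_function_def)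
    then show ?thesis
      using that unfolding \<psi>_def by (intro min.mono) auto
  qed
  have \<psi>_ge: "\<exists>d>0. \<forall>s. 0 < s \<longrightarrow> s \<le> d \<longrightarrow> c * s \<le> \<psi> s" if "0 < c" for c
  proof -
    have "\<forall>\<^sub>F r in at_right 0. c \<le> \<phi> r / r"
      using lim by (simp add: filterlim_at_top)
    then obtain b where b: "b > 0" "\<And>r. 0 < r \<Longrightarrow> r < b \<Longrightarrow> c \<le> \<phi> r / r"
      unfolding eventually_at_right_field by auto
    \<comment> \<open>At \<open>s = 1 / c\<^sup>2\<close> the line \<open>c * s\<close> meets
      \<open>sqrt s\<close>; halving \<open>b\<close> ensures \<open>s < b\<close>.\<close>
    define d where "d = min (b / 2) (1 / c\<^sup>2)"
    have "c * s \<le> \<psi> s" if "0 < s" "s \<le> d" for s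
    proof -
      have "c * s \<le> \<phi> s"
        using b(2)[of s] b(1) that by (simp add: d_def pos_le_divide_eq)
      moreover have "c\<^sup>2 * s \<le> 1"
        using that \<open>0 < c\<close> by (simp add: d_def field_simps)
      then have "(c\<^sup>2 * s) * s \<le> 1 * s"
        using that(1) by (intro mult_right_mono) auto
      then have "c * s \<le> sqrt s"
        by (intro real_le_rsqrt) (simp add: power2_eq_square algebra_simps)
      ultimately show ?thesis
        by (simp add: \<psi>_def)
    qed
    moreover have "0 < d"
      using b(1) \<open>0 < c\<close> by (simp add: d_def)
    ultimately show ?thesis
      by blast
  qed
  have "\<exists>d>0. (\<forall>s. 0 < s \<longrightarrow> s \<le> d \<longrightarrow> 4 * 32 ^ Suc n * s \<le> \<psi> s) \<and>
      (\<forall>f\<in>K. \<forall>x z. dist x z \<le> d \<longrightarrow> dist (apply_bcontfun f x) (apply_bcontfun f z) \<le> (1 / 2) ^ n / 32)" for n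
  proof -
    obtain d1 where d1: "d1 > 0" "\<And>s. 0 < s \<Longrightarrow> s \<le> d1 \<Longrightarrow> 4 * 32 ^ Suc n * s \<le> \<psi> s"
      using \<psi>_ge[of "4 * 32 ^ Suc n"] by auto
    obtain d2 where d2: "d2 > 0"
      "\<And>f x z. f \<in> K \<Longrightarrow> dist x z < d2 \<Longrightarrow> dist (apply_bcontfun f x) (apply_bcontfun f z) < (1 / 2) ^ n / 32"
      using compact_bcontfun_equicontinuous[OF \<open>compact K\<close>, of "(1 / 2) ^ n / 32"] by auto
    show ?thesis
    proof (intro exI[of _ "min d1 (d2 / 2)"] conjI allI ballI impI)
      show "0 < min d1 (d2 / 2)"
        using d1(1) d2(1) by simp
      show "4 * 32 ^ Suc n * s \<le> \<psi> s" if "0 < s" "s \<le> min d1 (d2 / 2)" for s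
        using that by (intro d1(2)) auto
      show "dist (apply_bcontfun f x) (apply_bcontfun f z) \<le> (1 / 2) ^ n / 32"
        if "f \<in> K" "dist x z \<le> min d1 (d2 / 2)" for f x z
        using d2(1) that by (intro less_imp_le[OF d2(2)]) auto
    qed
  qed
  then obtain \<delta> where \<delta>: "\<And>n. 0 < \<delta> n"
    "\<And>n s. 0 < s \<Longrightarrow> s \<le> \<delta> n \<Longrightarrow> 4 * 32 ^ Suc n * s \<le> \<psi> s"
    "\<And>n f x z. f \<in> K \<Longrightarrow> dist x z \<le> \<delta> n \<Longrightarrow> dist (apply_bcontfun f x) (apply_bcontfun f z) \<le> (1 / 2) ^ n / 32"
    by metis
  obtain m where m: "zigzag m" and p_le_\<delta>: "\<And>n. zigzag.p m n \<le> \<delta> n"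
    using ex_zigzag[of \<delta>] \<delta>(1) by blast
  interpret zigzag m
    by (fact m)
  define G :: C01 where "G = Bcontfun (\<lambda>x. g (Rep_unit_interval x))"
  have "(\<lambda>x. g (Rep_unit_interval x)) \<in> bcontfun"
  proof (rule bcontfun_normI)
    have "continuous_on UNIV Rep_unit_interval"
      by (auto simp: continuous_on_iff dist_unit_interval_def)
    then show "continuous_on UNIV (\<lambda>x. g (Rep_unit_interval x))"
      by (rule continuous_on_compose2[OF continuous_on_g[of UNIV]]) auto
    show "norm (g (Rep_unit_interval x)) \<le> 2" for x
      using g_tail_bounds[where n = 0 and x = "Rep_unit_interval x"] by (simp add: S_def)
  qed
  then have G: "apply_bcontfun G x = g (Rep_unit_interval x)" for x
    by (simp add: G_def Bcontfun_inverse)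
  have "0 < hausdorff_measure \<phi> (apply_bcontfun (f + G) -` {y})"
    if "f \<in> K" and y: "y \<in> {(INF x. apply_bcontfun (f + G) x)<..<(SUP x. apply_bcontfun (f + G) x)}" for f y
  proof -
    \<comment> \<open>Outside \<open>{0..1}\<close> the values of \<open>f'\<close> are unspecified;
      the locale assumptions concern \<open>{0..1}\<close> only.\<close>
    define f' where "f' x = apply_bcontfun f (Abs_unit_interval x)" for x
    interpret zigzag_perturbed m f' y \<psi>
    proof
      have "continuous_on {0..1} Abs_unit_interval"
        unfolding continuous_on_iff dist_unit_interval_def by (auto simp: Abs_unit_interval_inverse)
      then show "continuous_on {0..1} f'"
        unfolding f'_def[abs_def]
        by (rule continuous_on_compose2[of UNIV "apply_bcontfun f", rotated]) simp_all
      show "\<bar>f' x - f' z\<bar> \<le> (1 / 2) ^ n / 32"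
        if "x \<in> {0..1}" "z \<in> {0..1}" "\<bar>x - z\<bar> \<le> p n" for x z n
      proof -
        have "dist (Abs_unit_interval x) (Abs_unit_interval z) \<le> \<delta> n"
          using that p_le_\<delta>[of n] by (simp add: dist_unit_interval_def Abs_unit_interval_inverse dist_real_def)
        from \<delta>(3)[OF \<open>f \<in> K\<close> this] show ?thesis
          by (simp add: f'_def dist_real_def)
      qed
      show "4 * 32 ^ Suc n * s \<le> \<psi> s" if "0 < s" "s \<le> p n" for n s
        using that p_le_\<delta>[of n] by (intro \<delta>(2)) auto
    qed (rule \<psi>_mono)
    have h: "apply_bcontfun (f + G) x = f' (Rep_unit_interval x) + g (Rep_unit_interval x)" for x
      by (simp add: plus_bcontfun.rep_eq G f'_def Rep_unit_interval_inverse)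
    have "bounded (range (apply_bcontfun (f + G)))"
      using apply_bcontfun[of "f + G"] by (simp add: bcontfun_def)
    then have "bdd_below (range (apply_bcontfun (f + G)))" "bdd_above (range (apply_bcontfun (f + G)))"
      by (simp_all add: bounded_imp_bdd_below bounded_imp_bdd_above)
    then obtain u v where "apply_bcontfun (f + G) u < y" "y < apply_bcontfun (f + G) v"
      using y by (auto simp: cINF_less_iff less_cSUP_iff)
    then obtain n k where "R n k"
      using ex_R[of "Rep_unit_interval u" "Rep_unit_interval v"] Rep_unit_interval unfolding h by blast
    show ?thesis
    proof (rule hausdorff_measure_posI[where c = "w n" and \<psi> = \<psi>])
      show "0 < w n"
        by (rule w_pos)
      show "0 \<le> \<psi> s \<and> \<psi> s \<le> \<phi> s \<and> \<psi> s \<le> sqrt s" if "0 < s" for s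
        using \<psi>_pos[OF that] by (simp add: \<psi>_def)
      fix A :: "nat \<Rightarrow> unit_interval set" and s :: "nat \<Rightarrow> real"
      assume s: "\<And>i. 0 < s i" and A: "\<And>i x z. x \<in> A i \<Longrightarrow> z \<in> A i \<Longrightarrow> dist x z \<le> s i"
        and cover: "apply_bcontfun (f + G) -` {y} \<subseteq> (\<Union>i. A i)"
      show "ennreal (w n) \<le> (\<Sum>i. ennreal (\<psi> (s i)))"
      \<comment> \<open>\<open>Rep_unit_interval\<close> is an isometry, so the image of the cover
        keeps the size bounds \<open>s\<close>.\<close>
      proof (rule level_set_cover_sum_ge[OF s _ _ \<open>R n k\<close>])
        show "\<bar>x - z\<bar> \<le> s i" if "x \<in> Rep_unit_interval ` A i" "z \<in> Rep_unit_interval ` A i" for i x z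
          using that A by (auto simp: dist_unit_interval_def dist_real_def)
        show "{x \<in> {0..1}. f' x + g x = y} \<subseteq> (\<Union>i. Rep_unit_interval ` A i)"
        proof
          fix x assume x: "x \<in> {x \<in> {0..1}. f' x + g x = y}"
          then have "Rep_unit_interval (Abs_unit_interval x) = x"
            by (simp add: Abs_unit_interval_inverse)
          with x have "Abs_unit_interval x \<in> apply_bcontfun (f + G) -` {y}"
            by (simp add: h del: plus_bcontfun.rep_eq)
          with cover obtain i where "Abs_unit_interval x \<in> A i"
            by blast
          then show "x \<in> (\<Union>i. Rep_unit_interval ` A i)"
            using \<open>Rep_unit_interval (Abs_unit_interval x) = x\<close> by (metis UN_I UNIV_I imageI)
        qed
      qed
    qed
  qed
  then show ?thesis
    by (rule that)
qed

section \<open>Shyness tested on compact sets\<close>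

text \<open>By inner regularity a witness measure charges some compact \<open>K\<close>. Moving
  \<open>K\<close> into \<open>A\<close> by \<open>g\<close> places \<open>K\<close> inside the
  translate of \<open>B\<close> by \<open>- g\<close>, which is null.\<close>

lemma not_shyI:
  fixes A :: "'a::{topological_ab_group_add, polish_space} set"
  assumes "\<And>K. compact K \<Longrightarrow> \<exists>g. \<forall>f\<in>K. f + g \<in> A"
  shows "\<not> shy A"
proof
  assume "shy A"
  then obtain B and \<nu> :: "'a measure" where B: "B \<in> sets borel" "A \<subseteq> B" and \<nu>: "prob_space \<nu>" "sets \<nu> = sets borel"
    and null: "\<And>x. emeasure \<nu> ((\<lambda>b. b + x) ` B) = 0"
    unfolding shy_def by blast
  interpret prob_space \<nu>
    by (fact \<nu>(1))
  have sp: "space \<nu> = UNIV"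
    using sets_eq_imp_space_eq[OF \<nu>(2)] by simp
  have "emeasure \<nu> UNIV = (SUP K\<in>{K. K \<subseteq> UNIV \<and> compact K}. emeasure \<nu> K)"
    by (rule inner_regular) (use \<nu>(2) in auto)
  moreover have "emeasure \<nu> UNIV = 1"
    using emeasure_space_1 sp by simp
  ultimately have "0 < (SUP K\<in>{K. K \<subseteq> UNIV \<and> compact K}. emeasure \<nu> K)"
    by simp
  then obtain K where "compact K" and K: "0 < emeasure \<nu> K"
    by (auto simp: less_SUP_iff)
  then obtain g where g: "\<And>f. f \<in> K \<Longrightarrow> f + g \<in> A"
    using assms by blast
  have eq: "(\<lambda>b. b + - g) ` B = (\<lambda>z. z + g) -` B \<inter> space borel"
    by (force simp: image_iff algebra_simps)
  have "(\<lambda>z. z + g) \<in> borel_measurable borel"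
    by (intro borel_measurable_continuous_onI continuous_intros)
  then have "(\<lambda>z. z + g) -` B \<inter> space borel \<in> sets borel"
    using B(1) by (rule measurable_sets)
  moreover have "K \<subseteq> (\<lambda>z. z + g) -` B \<inter> space borel"
    using g B(2) by auto
  ultimately have "emeasure \<nu> K \<le> emeasure \<nu> ((\<lambda>b. b + - g) ` B)"
    unfolding eq by (intro emeasure_mono) (simp_all add: \<nu>(2))
  with K null[of "- g"] show False
    by simp
qed

theorem theorem8p3:
  fixes \<phi> :: "real \<Rightarrow> real"
  assumes "gauge_function \<phi>"
    and "filterlim (\<lambda>r. \<phi> r / r) at_top (at_right 0)"
  shows "\<not> shy {f :: C01.
           \<forall>y \<in> {(INF x. apply_bcontfun f x)<..<(SUP x. apply_bcontfun f x)}.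
             hausdorff_measure \<phi> (apply_bcontfun f -` {y}) > 0}"
proof (rule not_shyI)
  fix K :: "C01 set"
  assume "compact K"
  then obtain G :: C01 where "\<And>f y. f \<in> K \<Longrightarrow>
      y \<in> {(INF x. apply_bcontfun (f + G) x)<..<(SUP x. apply_bcontfun (f + G) x)} \<Longrightarrow>
      0 < hausdorff_measure \<phi> (apply_bcontfun (f + G) -` {y})"
    using ex_translate_of_compact[OF assms] by blast
  then show "\<exists>G. \<forall>f\<in>K. f + G \<in> {f :: C01.
           \<forall>y \<in> {(INF x. apply_bcontfun f x)<..<(SUP x. apply_bcontfun f x)}.
             hausdorff_measure \<phi> (apply_bcontfun f -` {y}) > 0}"
    by blast
qed

end
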